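(* Let $\mathcal{X}$ be a finite state space, $\pi$ a probability mass function on $\mathcal{X}$ with full support, and $m \in \mathbb{N}$, $m\ge1$. Let $P \in \mathcal{L}(\pi)$ and let $Q_0,\ldots,Q_{m-1} \in \mathcal{I}(\pi) \cap \mathcal{L}$ be isometric involution transition matrices. Define $R_0:=P$ and, for $n\ge1$, $$R_n := \overline{R_{n-1}}(Q_{(n-1) \bmod m}).$$ Then the following limit exists (pointwise or, equivalently, in the $\pi$-weighted total variation distance $D^\pi_{TV}$): $$ \lim_{n \to \infty} R_n = R_\infty, $$ where $R_\infty$ is the unique minimizer of $N\mapsto D^\pi_{KL}(P\|N)$ over $N\in\mathcal{E}:=\bigcap_{k=0}^{m-1}\mathcal{L}(\pi,Q_k)$. Moreover, $$ R_\infty \in \mathcal{L}(\pi) \cap \mathcal{E}, \qquad \mathrm{Tr}(R_\infty) = \mathrm{Tr}(P). $$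
   Context: $\mathcal{L}$ is the set of transition (row-stochastic) matrices on $\mathcal{X}$; $\mathcal{S}(\pi)\subseteq\mathcal{L}$ is the set of those with $\pi P=\pi$. For a matrix $M$, $M^*(x,y)=\frac{\pi(y)}{\pi(x)}M(y,x)$. $\mathcal{L}(\pi)$ is the set of $\pi$-reversible transition matrices ($P=P^*$). $\mathcal{I}(\pi)$ is the set of real matrices $Q$ with $Q^2=I$ and $Q^*=Q$. $\mathcal{L}(\pi,Q)$ is the set of $L\in\mathcal{S}(\pi)$ with $L^*=QLQ$. For $P\in\mathcal{S}(\pi)$ and $Q \in \mathcal{I}(\pi) \cap \mathcal{L}$, $\overline{P}(Q):=\frac12(P+QP^*Q)$. For $M,N\in\mathcal{L}$, $D^\pi_{KL}(M\|N):=\sum_x\pi(x)\sum_y M(x,y)\ln\frac{M(x,y)}{N(x,y)}\in[0,\infty]$, with $0\ln(0/0)=0$, $0\cdot\infty=0$ and $a\ln(a/0)=+\infty$ for $a>0$, and $D^\pi_{TV}(M,N):=\sum_x\pi(x)\sum_y|M(x,y)-N(x,y)|$. *)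

theory Defs
  imports "HOL-Analysis.Analysis"
begin

text \<open>The finite state space is the type \<open>'x\<close>; a matrix \<open>M\<close> on it has type
  \<open>real^'x^'x\<close>, and \<open>M $ x $ y\<close> is its entry in row \<open>x\<close> and column \<open>y\<close>.\<close>

definition full_support_pmf :: "real^'x \<Rightarrow> bool" where
  "full_support_pmf \<pi> \<longleftrightarrow> (\<forall>x. 0 < \<pi> $ x) \<and> (\<Sum>x\<in>UNIV. \<pi> $ x) = 1"

definition transition_matrices :: "(real^'x^'x) set" where
  "transition_matrices = {P. (\<forall>x y. 0 \<le> P $ x $ y) \<and> (\<forall>x. (\<Sum>y\<in>UNIV. P $ x $ y) = 1)}"

definition stationary_matrices :: "real^'x \<Rightarrow> (real^'x^'x) set" where
  "stationary_matrices \<pi> = {P \<in> transition_matrices. \<pi> v* P = \<pi>}"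

definition pi_adjoint :: "real^'x \<Rightarrow> real^'x^'x \<Rightarrow> real^'x^'x" where
  "pi_adjoint \<pi> M = (\<chi> x y. \<pi> $ y / \<pi> $ x * M $ y $ x)"

definition reversible_matrices :: "real^'x \<Rightarrow> (real^'x^'x) set" where
  "reversible_matrices \<pi> = {P \<in> transition_matrices. P = pi_adjoint \<pi> P}"

definition isometric_involutions :: "real^'x \<Rightarrow> (real^'x^'x) set" where
  "isometric_involutions \<pi> = {Q. Q ** Q = mat 1 \<and> pi_adjoint \<pi> Q = Q}"

definition Q_reversible_matrices :: "real^'x \<Rightarrow> real^'x^'x \<Rightarrow> (real^'x^'x) set" where
  "Q_reversible_matrices \<pi> Q =
     {L \<in> stationary_matrices \<pi>. pi_adjoint \<pi> L = Q ** L ** Q}"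

definition Q_average :: "real^'x \<Rightarrow> real^'x^'x \<Rightarrow> real^'x^'x \<Rightarrow> real^'x^'x" where
  "Q_average \<pi> P Q = (1/2) *\<^sub>R (P + Q ** pi_adjoint \<pi> P ** Q)"

text \<open>The summand \<open>a ln (a/b)\<close> for \<open>a, b \<ge> 0\<close>, with \<open>0 ln (0/b) = 0\<close> also for \<open>b = 0\<close>,
  and \<open>a ln (a/0) = \<infinity>\<close> for \<open>a > 0\<close>. The divergence is extended-real valued.\<close>

definition kl_term :: "real \<Rightarrow> real \<Rightarrow> ereal" where
  "kl_term a b = (if a = 0 then 0 else if b = 0 then \<infinity> else ereal (a * ln (a / b)))"

definition KL_div :: "real^'x \<Rightarrow> real^'x^'x \<Rightarrow> real^'x^'x \<Rightarrow> ereal" where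
  "KL_div \<pi> M N = (\<Sum>x\<in>UNIV. ereal (\<pi> $ x) * (\<Sum>y\<in>UNIV. kl_term (M $ x $ y) (N $ x $ y)))"

definition TV_dist :: "real^'x \<Rightarrow> real^'x^'x \<Rightarrow> real^'x^'x \<Rightarrow> real" where
  "TV_dist \<pi> M N = (\<Sum>x\<in>UNIV. \<pi> $ x * (\<Sum>y\<in>UNIV. \<bar>M $ x $ y - N $ x $ y\<bar>))"

primrec alternating_average ::
  "real^'x \<Rightarrow> nat \<Rightarrow> (nat \<Rightarrow> real^'x^'x) \<Rightarrow> real^'x^'x \<Rightarrow> nat \<Rightarrow> real^'x^'x" where
  "alternating_average \<pi> m Q P 0 = P"
| "alternating_average \<pi> m Q P (Suc n) =
     Q_average \<pi> (alternating_average \<pi> m Q P n) (Q (n mod m))"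

end

theory Submission imports Defs begin

text \<open>A stochastic isometric involution is the permutation matrix of an involution \<open>\<sigma>\<close> that preserves
  \<open>\<pi>\<close>, so on reversible matrices the average replaces \<open>X\<close> by the midpoint of \<open>X\<close> and its conjugate
  under \<open>\<sigma>\<close>, which is an isometry of the Frobenius norm. Such cyclic averages converge: the distance
  to any common fixed point decreases, and by compactness and Pythagoras some subsequence tends to a
  common fixed point. If \<open>g (\<sigma> x) (\<sigma> y) = g y x\<close> for all the involutions, then
  \<open>\<Sum>x y. \<pi> x * X x y * g x y\<close> is constant along the iteration. A suitable \<open>g\<close> gives the trace,
  indicators of null sets give absolute continuity, and \<open>g x y = ln (\<pi> x * N x y)\<close>, which
  has this symmetry exactly because \<open>N \<in> E\<close>, gives the Pythagorean identity
  \<open>D(P, N) = D(P, R\<^sub>\<infinity>) + D(R\<^sub>\<infinity>, N)\<close>. Gibbs' inequality finishes the proof.\<close>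

section \<open>Stochastic isometric involutions as permutations\<close>

lemma isometric_involution_permutation:
  fixes \<pi> :: "real^'x" and Q :: "real^'x^'x"
  assumes \<pi>: "full_support_pmf \<pi>"
    and Q: "Q \<in> isometric_involutions \<pi> \<inter> transition_matrices"
  obtains \<sigma> where "\<And>x. \<sigma> (\<sigma> x) = x" and "\<And>x. \<pi> $ \<sigma> x = \<pi> $ x"
    and "\<And>X x y. (Q ** X ** Q) $ x $ y = X $ \<sigma> x $ \<sigma> y"
proof -
  have pos: "0 < \<pi> $ x" for x
    using \<pi> by (auto simp: full_support_pmf_def)
  have nonneg: "0 \<le> Q $ x $ y" and row: "(\<Sum>y\<in>UNIV. Q $ x $ y) = 1" for x y
    using Q by (auto simp: transition_matrices_def)
  have "pi_adjoint \<pi> Q = Q"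
    using Q by (auto simp: isometric_involutions_def)
  then have adj: "\<pi> $ x * Q $ x $ y = \<pi> $ y * Q $ y $ x" for x y
  proof -
    have "\<pi> $ y / \<pi> $ x * Q $ y $ x = Q $ x $ y"
      using \<open>pi_adjoint \<pi> Q = Q\<close> by (metis (no_types, lifting) pi_adjoint_def vec_lambda_beta)
    then show ?thesis
      using pos[of x] by (simp add: field_simps)
  qed
  have "Q ** Q = mat 1"
    using Q by (auto simp: isometric_involutions_def)
  then have sq: "(\<Sum>z\<in>UNIV. Q $ x $ z * Q $ z $ y) = (if x = y then 1 else 0)" for x y
    by (simp add: matrix_matrix_mult_def mat_def vec_eq_iff)
  \<comment> \<open>For \<open>y\<close> other than \<open>x\<close>, the entry
    \<open>(x, y)\<close> of \<open>Q ** Q\<close> is 0 and a sum of nonnegative terms, so each term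
    vanishes. Row \<open>z\<close> thus has all its mass at \<open>x\<close>.\<close>
  have reverse: "Q $ z $ x = 1" if "0 < Q $ x $ z" for x z
  proof -
    have "Q $ z $ y = 0" if "y \<noteq> x" for y
    proof -
      have "(\<Sum>z\<in>UNIV. Q $ x $ z * Q $ z $ y) = 0"
        using that sq[of x y] by simp
      then have "Q $ x $ z * Q $ z $ y = 0"
        by (subst (asm) sum_nonneg_eq_0_iff) (auto simp: nonneg)
      then show ?thesis
        using \<open>0 < Q $ x $ z\<close> by simp
    qed
    then have "(\<Sum>y\<in>UNIV. Q $ z $ y) = (\<Sum>y\<in>UNIV. if y = x then Q $ z $ x else 0)"
      by (intro sum.cong) auto
    then show ?thesis
      using row[of z] by simp
  qed
  have "\<exists>z. 0 < Q $ x $ z" for x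
  proof (rule ccontr)
    assume "\<nexists>z. 0 < Q $ x $ z"
    then have "Q $ x $ z = 0" for z
      using nonneg[of x z] by (simp add: not_less order_antisym)
    then show False
      using row[of x] by simp
  qed
  then obtain \<sigma> where \<sigma>_pos: "0 < Q $ x $ \<sigma> x" for x
    by metis
  have \<sigma>1: "Q $ \<sigma> x $ x = 1" and \<sigma>2: "Q $ x $ \<sigma> x = 1" for x
  proof -
    show 1: "Q $ \<sigma> x $ x = 1"
      by (rule reverse[OF \<sigma>_pos])
    show "Q $ x $ \<sigma> x = 1"
      by (rule reverse) (simp add: 1)
  qed
  have other: "Q $ x $ y = 0" if "y \<noteq> \<sigma> x" for x y
  proof -
    have "(\<Sum>y\<in>UNIV - {\<sigma> x}. Q $ x $ y) = 0"
      using row[of x] \<sigma>2[of x] by (simp add: sum_diff1)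
    then show ?thesis
      using that by (subst (asm) sum_nonneg_eq_0_iff) (auto simp: nonneg)
  qed
  have inv: "\<sigma> (\<sigma> x) = x" for x
    using \<sigma>1[of x] other[of x "\<sigma> x"] by fastforce
  have entry: "Q $ x $ y = (if y = \<sigma> x then 1 else 0)" for x y
    using other \<sigma>2 by simp
  \<comment> \<open>Solved for the row index, this form collapses the sum for the right factor, as
    \<open>entry\<close> does for the left one.\<close>
  have entry': "Q $ x $ y = (if x = \<sigma> y then 1 else 0)" for x y
    using entry[of x y] inv by metis
  have mult: "(Q ** X ** Q) $ x $ y = X $ \<sigma> x $ \<sigma> y" for X :: "real^'x^'x" and x y
  proof -
    have "(Q ** X) $ x $ z = X $ \<sigma> x $ z" for z
      by (simp add: matrix_matrix_mult_def entry if_distrib[of "\<lambda>t. t * _"] cong: if_cong)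
    then show ?thesis
      by (simp add: matrix_matrix_mult_def[of "Q ** X"] entry' if_distrib[of "\<lambda>t. _ * t"] cong: if_cong)
  qed
  have "\<pi> $ \<sigma> x = \<pi> $ x" for x
    using adj[of x "\<sigma> x"] by (simp add: \<sigma>1 \<sigma>2)
  then show thesis
    using that inv mult by blast
qed

section \<open>Convergence of cyclic averages of linear isometries\<close>

lemma cyclic_averages_converge:
  fixes X :: "nat \<Rightarrow> 'a::euclidean_space" and S :: "nat \<Rightarrow> 'a \<Rightarrow> 'a"
  assumes m: "1 \<le> m"
    and step: "\<And>n. X (Suc n) = (1/2) *\<^sub>R (X n + S (n mod m) (X n))"
    and lin: "\<And>k. k < m \<Longrightarrow> linear (S k)"
    and iso: "\<And>k v. k < m \<Longrightarrow> norm (S k v) = norm v"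
  obtains L where "X \<longlonglongrightarrow> L" and "\<And>k. k < m \<Longrightarrow> S k L = L"
proof -
  have modm: "n mod m < m" for n
    using m by simp
  \<comment> \<open>The new error is the mean of \<open>X n - Z\<close> and an isometric image of
    it. The choice \<open>Z = 0\<close> gives boundedness, \<open>Z = L\<close> convergence.\<close>
  have fejer: "norm (X (Suc n) - Z) \<le> norm (X n - Z)" if "\<And>k. k < m \<Longrightarrow> S k Z = Z" for Z n
  proof -
    have "X (Suc n) - Z = (1/2) *\<^sub>R ((X n - Z) + S (n mod m) (X n - Z))"
      by (simp add: step linear_diff[OF lin[OF modm]] that[OF modm] algebra_simps
          flip: scaleR_left_distrib)
    also have "norm \<dots> \<le> (1/2) * (norm (X n - Z) + norm (S (n mod m) (X n - Z)))"
      by (simp add: norm_triangle_ineq)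
    finally show ?thesis
      by (simp add: iso[OF modm])
  qed
  have S0: "S k 0 = 0" if "k < m" for k
    using lin[OF that] by (rule linear_0)
  have decn: "decseq (\<lambda>n. norm (X n))"
    using fejer[of 0] S0 by (simp add: decseq_Suc_iff)
  \<comment> \<open>Equal norms make \<open>v + w\<close> and \<open>v - w\<close> orthogonal. As
    the decreasing norms converge, the gaps tend to 0.\<close>
  have pyth: "(norm (X (Suc n) - X n))\<^sup>2 = (norm (X n))\<^sup>2 - (norm (X (Suc n)))\<^sup>2" for n
  proof -
    define v w where "v = X n" and "w = S (n mod m) (X n)"
    have "w \<bullet> w = v \<bullet> v"
      using iso[OF modm, of n "X n"] by (simp add: v_def w_def norm_eq)
    moreover have "X (Suc n) = (1/2) *\<^sub>R (v + w)" "X n = v"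
      by (simp_all add: step v_def w_def)
    ultimately show ?thesis
      by (simp add: power2_norm_eq_inner inner_diff_left inner_diff_right inner_add_left
          inner_add_right inner_commute field_simps)
  qed
  have "Bseq (\<lambda>n. norm (X n))"
    by (rule BseqI'[of _ "norm (X 0)"]) (use decn in \<open>simp add: decseq_def\<close>)
  then obtain c where c: "(\<lambda>n. norm (X n)) \<longlonglongrightarrow> c"
    using decn Bseq_monoseq_convergent convergent_def decseq_imp_monoseq by blast
  have "(\<lambda>n. (norm (X (Suc n) - X n))\<^sup>2) \<longlonglongrightarrow> c\<^sup>2 - c\<^sup>2"
    unfolding pyth using c LIMSEQ_Suc[OF c] by (intro tendsto_intros)
  then have "(\<lambda>n. sqrt ((norm (X (Suc n) - X n))\<^sup>2)) \<longlonglongrightarrow> sqrt 0"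
    by (intro tendsto_real_sqrt) simp
  then have gap: "(\<lambda>n. X (Suc n) - X n) \<longlonglongrightarrow> 0"
    by (simp add: tendsto_norm_zero_iff)
  \<comment> \<open>Sampling at multiples of \<open>m\<close> fixes the phase: for
    \<open>k < m\<close>, the step from time \<open>m * r i + k\<close> applies
    \<open>S k\<close>.\<close>
  have "X (m * n) \<in> cball 0 (norm (X 0))" for n
    using decn by (simp add: decseq_def)
  then obtain L r where r: "strict_mono r" and "((\<lambda>n. X (m * n)) \<circ> r) \<longlonglongrightarrow> L"
    using compact_cball[of "0::'a" "norm (X 0)"] unfolding compact_def by metis
  then have sub0: "(\<lambda>i. X (m * r i)) \<longlonglongrightarrow> L"
    by (simp add: o_def)
  have mono: "strict_mono (\<lambda>i. m * r i + k)" for k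
    using r m by (simp add: strict_mono_def)
  \<comment> \<open>Vanishing gaps carry the subsequential limit to every fixed shift, so one
    \<open>L\<close> serves all phases.\<close>
  have sub: "(\<lambda>i. X (m * r i + k)) \<longlonglongrightarrow> L" for k
  proof (induction k)
    case (Suc k)
    have "(\<lambda>i. X (Suc (m * r i + k)) - X (m * r i + k)) \<longlonglongrightarrow> 0"
      using LIMSEQ_subseq_LIMSEQ[OF gap mono[of k]] by (simp add: o_def)
    from tendsto_add[OF this Suc] show ?case
      by simp
  qed (use sub0 in simp)
  \<comment> \<open>In the limit of the step at phase \<open>k\<close>, \<open>L\<close> is the
    midpoint of \<open>L\<close> and \<open>S k L\<close>.\<close>
  have fix_L: "S k L = L" if k: "k < m" for k
  proof -
    have "(\<lambda>i. S k (X (m * r i + k))) \<longlonglongrightarrow> S k L"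
      using linear_continuous_at[of "S k"] lin[OF k] sub[of k]
      by (metis isCont_tendsto_compose linear_conv_bounded_linear)
    then have "(\<lambda>i. (1/2) *\<^sub>R (X (m * r i + k) + S k (X (m * r i + k)))) \<longlonglongrightarrow> (1/2) *\<^sub>R (L + S k L)"
      using sub[of k] by (intro tendsto_intros)
    moreover have "X (m * r i + Suc k) = (1/2) *\<^sub>R (X (m * r i + k) + S k (X (m * r i + k)))" for i
      using step[of "m * r i + k"] k by simp
    ultimately have "(1/2) *\<^sub>R (L + S k L) = L"
      using sub[of "Suc k"] by (simp add: LIMSEQ_unique)
    then have "2 *\<^sub>R ((1/2) *\<^sub>R (L + S k L)) = 2 *\<^sub>R L"
      by simp
    then show ?thesis
      by (simp add: scaleR_2)
  qed
  \<comment> \<open>Now that \<open>L\<close> is a common fixed point, one small distance along the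
    subsequence bounds all later ones.\<close>
  have dec: "decseq (\<lambda>n. norm (X n - L))"
    using fejer fix_L by (simp add: decseq_Suc_iff)
  have "X \<longlonglongrightarrow> L"
  proof (rule LIMSEQ_I)
    fix e :: real
    assume "0 < e"
    then obtain i where i: "norm (X (m * r i) - L) < e"
      using LIMSEQ_D[OF sub0] by blast
    have "norm (X n - L) < e" if "m * r i \<le> n" for n
      using decseqD[OF dec that] i by simp
    then show "\<exists>no. \<forall>n\<ge>no. norm (X n - L) < e"
      by blast
  qed
  then show thesis
    using fix_L that by blast
qed

section \<open>Conjugation by an involution of the index set\<close>

lemma sum_sum_conjugate:
  fixes f :: "'x::finite \<Rightarrow> 'x \<Rightarrow> 'b::comm_monoid_add"
  assumes "\<And>x. \<sigma> (\<sigma> x) = x"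
  shows "(\<Sum>x\<in>UNIV. \<Sum>y\<in>UNIV. f (\<sigma> x) (\<sigma> y)) = (\<Sum>x\<in>UNIV. \<Sum>y\<in>UNIV. f x y)"
proof -
  have "bij \<sigma>"
    using assms by (metis bijI')
  then show ?thesis
    by (simp add: sum.reindex_bij_betw[of \<sigma> UNIV UNIV "f (\<sigma> _)"]
        sum.reindex_bij_betw[of \<sigma> UNIV UNIV "\<lambda>x. sum (f x) UNIV"])
qed

lemma norm_conjugate_permutation:
  fixes X :: "real^'x^'x"
  assumes "\<And>x. \<sigma> (\<sigma> x) = x"
  shows "norm (\<chi> x y. X $ \<sigma> x $ \<sigma> y) = norm X"
  unfolding norm_eq inner_vec_def
  using sum_sum_conjugate[of \<sigma> "\<lambda>x y. X $ x $ y \<bullet> X $ x $ y", OF assms] by simp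

section \<open>Gibbs' inequality\<close>

lemma gibbs_term:
  fixes a b :: real
  assumes "0 \<le> a" "0 \<le> b" and "b = 0 \<Longrightarrow> a = 0"
  shows "a - b \<le> a * ln a - a * ln b"
    and "a * ln a - a * ln b = a - b \<Longrightarrow> a = b"
proof -
  have *: "a - b \<le> a * ln a - a * ln b \<and> (a * ln a - a * ln b = a - b \<longrightarrow> a = b)"
  proof (cases "a = 0")
    case False
    then have pos: "0 < a" "0 < b"
      using assms by (auto simp: order_less_le)
    then have "a * ln a - a * ln b = - (a * ln (b / a))"
      by (simp add: ln_div algebra_simps)
    moreover have "ln (b / a) \<le> b / a - 1"
      using pos by (intro ln_le_minus_one) simp
    moreover have "b / a = 1" if "ln (b / a) = b / a - 1"
      using pos that by (intro ln_eq_minus_one) auto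
    moreover have "a * (b / a - 1) = b - a"
      using pos by (simp add: field_simps)
    ultimately show ?thesis
      using pos by (smt (verit) mult_left_mono mult_cancel_left divide_eq_1_iff)
  qed (use assms in auto)
  from * show "a - b \<le> a * ln a - a * ln b"
    by simp
  from * show "a * ln a - a * ln b = a - b \<Longrightarrow> a = b"
    by simp
qed

text \<open>Summing \<open>gibbs_term\<close> suffices: equal totals cancel the linear terms, and
  the index with \<open>a i \<noteq> b i\<close> makes the sum strict.\<close>

lemma gibbs_strict:
  fixes a b :: "'i \<Rightarrow> real"
  assumes "finite I"
    and "\<And>i. i \<in> I \<Longrightarrow> 0 \<le> a i" "\<And>i. i \<in> I \<Longrightarrow> 0 \<le> b i"
    and "\<And>i. i \<in> I \<Longrightarrow> b i = 0 \<Longrightarrow> a i = 0"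
    and "sum a I = sum b I" and "i \<in> I" "a i \<noteq> b i"
  shows "(\<Sum>i\<in>I. a i * ln (b i)) < (\<Sum>i\<in>I. a i * ln (a i))"
proof -
  have "(\<Sum>i\<in>I. a i - b i) < (\<Sum>i\<in>I. a i * ln (a i) - a i * ln (b i))"
  proof (rule sum_strict_mono_ex1)
    show "\<forall>i\<in>I. a i - b i \<le> a i * ln (a i) - a i * ln (b i)"
      using gibbs_term(1) assms by blast
    have "a i - b i < a i * ln (a i) - a i * ln (b i)"
      using gibbs_term[of "a i" "b i"] assms by force
    then show "\<exists>i\<in>I. a i - b i < a i * ln (a i) - a i * ln (b i)"
      using assms by blast
  qed (rule assms)
  then show ?thesis
    using assms by (simp add: sum_subtractf)
qed

section \<open>Reversible matrices\<close>

lemma reversible_matrices_iff: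
  assumes "full_support_pmf \<pi>"
  shows "X \<in> reversible_matrices \<pi> \<longleftrightarrow>
    X \<in> transition_matrices \<and> (\<forall>x y. \<pi> $ x * X $ x $ y = \<pi> $ y * X $ y $ x)"
proof -
  have "0 < \<pi> $ x" for x
    using assms by (auto simp: full_support_pmf_def)
  then have "X = pi_adjoint \<pi> X \<longleftrightarrow> (\<forall>x y. \<pi> $ x * X $ x $ y = \<pi> $ y * X $ y $ x)"
    by (simp add: pi_adjoint_def vec_eq_iff field_simps less_imp_neq[THEN not_sym])
  then show ?thesis
    by (simp add: reversible_matrices_def)
qed

lemma reversible_imp_stationary:
  assumes "full_support_pmf \<pi>" "X \<in> reversible_matrices \<pi>"
  shows "X \<in> stationary_matrices \<pi>"
proof -
  have "X \<in> transition_matrices" and rev: "\<pi> $ x * X $ x $ y = \<pi> $ y * X $ y $ x" for x y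
    using assms reversible_matrices_iff by blast+
  have "(\<Sum>x\<in>UNIV. \<pi> $ x * X $ x $ y) = (\<Sum>x\<in>UNIV. \<pi> $ y * X $ y $ x)" for y
    by (intro sum.cong refl rev)
  then have "(\<Sum>x\<in>UNIV. \<pi> $ x * X $ x $ y) = \<pi> $ y" for y
    using \<open>X \<in> transition_matrices\<close> by (simp add: transition_matrices_def flip: sum_distrib_left)
  then show ?thesis
    using \<open>X \<in> transition_matrices\<close>
    by (simp add: stationary_matrices_def vec_eq_iff vector_matrix_mult_def mult.commute)
qed

text \<open>Nonnegativity, row sums and detailed balance are closed conditions on the entries, so a
  limit of reversible iterates is reversible.\<close>

lemma closed_reversible_matrices:
  fixes \<pi> :: "real^'x"
  assumes "full_support_pmf \<pi>"
  shows "closed (reversible_matrices \<pi>)"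
proof -
  have "reversible_matrices \<pi> = (\<Inter>x. \<Inter>y. {X. 0 \<le> X $ x $ y}) \<inter>
    (\<Inter>x. {X. (\<Sum>y\<in>UNIV. X $ x $ y) = 1}) \<inter>
    (\<Inter>x. \<Inter>y. {X. \<pi> $ x * X $ x $ y = \<pi> $ y * X $ y $ x})"
    using reversible_matrices_iff[OF assms] by (auto simp: transition_matrices_def)
  then show ?thesis
    by (auto intro!: closed_Int closed_INT closed_Collect_le closed_Collect_eq continuous_intros)
qed

section \<open>The Kullback-Leibler divergence\<close>

lemma KL_div_eq_infinity:
  assumes "full_support_pmf \<pi>" "M $ x $ y \<noteq> 0" "N $ x $ y = 0"
  shows "KL_div \<pi> M N = \<infinity>"
proof -
  have pos: "0 < \<pi> $ x" for x
    using assms by (auto simp: full_support_pmf_def)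
  have "(\<Sum>y\<in>UNIV. kl_term (M $ x $ y) (N $ x $ y)) = \<infinity>"
    unfolding sum_Pinfty using assms by (auto simp: kl_term_def intro!: exI[of _ y])
  then have "ereal (\<pi> $ x) * (\<Sum>y\<in>UNIV. kl_term (M $ x $ y) (N $ x $ y)) = \<infinity>"
    using pos[of x] by simp
  then show ?thesis
    unfolding KL_div_def sum_Pinfty by auto
qed

text \<open>Isolates a cross term linear in \<open>M\<close>, to which conservation laws can be
  applied. The weights \<open>\<pi> $ x\<close> inside the two logarithms cancel.\<close>

lemma KL_div_finite:
  assumes \<pi>: "full_support_pmf \<pi>"
    and M: "\<And>x y. 0 \<le> M $ x $ y" and N: "\<And>x y. 0 \<le> N $ x $ y"
    and ac: "\<And>x y. N $ x $ y = 0 \<Longrightarrow> M $ x $ y = 0"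
  shows "KL_div \<pi> M N =
    ereal ((\<Sum>x\<in>UNIV. \<Sum>y\<in>UNIV. \<pi> $ x * M $ x $ y * ln (\<pi> $ x * M $ x $ y)) -
      (\<Sum>x\<in>UNIV. \<Sum>y\<in>UNIV. \<pi> $ x * M $ x $ y * ln (\<pi> $ x * N $ x $ y)))"
proof -
  have pos: "0 < \<pi> $ x" for x
    using \<pi> by (auto simp: full_support_pmf_def)
  have kl: "kl_term (M $ x $ y) (N $ x $ y) = ereal (M $ x $ y * ln (M $ x $ y / N $ x $ y))" for x y
    using ac by (auto simp: kl_term_def)
  have "\<pi> $ x * (M $ x $ y * ln (M $ x $ y / N $ x $ y)) =
    \<pi> $ x * M $ x $ y * ln (\<pi> $ x * M $ x $ y) - \<pi> $ x * M $ x $ y * ln (\<pi> $ x * N $ x $ y)" for x y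
  proof (cases "M $ x $ y = 0")
    case False
    then have "0 < M $ x $ y" "0 < N $ x $ y"
      using M N ac by (metis order_less_le)+
    then show ?thesis
      using pos[of x] by (simp add: ln_div ln_mult algebra_simps)
  qed simp
  then show ?thesis
    by (simp add: KL_div_def kl sum_distrib_left sum_subtractf)
qed

section \<open>Reversible matrices under conjugation and averaging\<close>

lemma reversible_sum_conjugate:
  fixes \<pi> :: "real^'x" and X :: "real^'x^'x"
  assumes "full_support_pmf \<pi>" "X \<in> reversible_matrices \<pi>"
    and \<sigma>: "\<And>x. \<sigma> (\<sigma> x) = x" "\<And>x. \<pi> $ \<sigma> x = \<pi> $ x"
    and g: "\<And>x y. g (\<sigma> x) (\<sigma> y) = g y x"
  shows "(\<Sum>x\<in>UNIV. \<Sum>y\<in>UNIV. \<pi> $ x * X $ \<sigma> x $ \<sigma> y * g x y) =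
    (\<Sum>x\<in>UNIV. \<Sum>y\<in>UNIV. \<pi> $ x * X $ x $ y * g x y)"
proof -
  have rev: "\<pi> $ x * X $ x $ y = \<pi> $ y * X $ y $ x" for x y
    using assms(1,2) reversible_matrices_iff by blast
  \<comment> \<open>Reindexing moves the conjugation from \<open>X\<close> to \<open>g\<close>,
    where it acts as a transposition; detailed balance and exchanging the sums undo that.\<close>
  have "(\<Sum>x\<in>UNIV. \<Sum>y\<in>UNIV. \<pi> $ x * X $ \<sigma> x $ \<sigma> y * g x y) =
    (\<Sum>x\<in>UNIV. \<Sum>y\<in>UNIV. \<pi> $ \<sigma> x * X $ \<sigma> (\<sigma> x) $ \<sigma> (\<sigma> y) * g (\<sigma> x) (\<sigma> y))"
    by (rule sum_sum_conjugate[symmetric]) (rule \<sigma>)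
  also have "\<dots> = (\<Sum>x\<in>UNIV. \<Sum>y\<in>UNIV. \<pi> $ y * X $ y $ x * g y x)"
    by (simp add: \<sigma> g flip: rev)
  also have "\<dots> = (\<Sum>x\<in>UNIV. \<Sum>y\<in>UNIV. \<pi> $ x * X $ x $ y * g x y)"
    by (rule sum.swap)
  finally show ?thesis .
qed

lemma reversible_conjugate:
  fixes \<pi> :: "real^'x"
  assumes \<pi>: "full_support_pmf \<pi>" and X: "X \<in> reversible_matrices \<pi>"
    and \<sigma>: "\<And>x. \<sigma> (\<sigma> x) = x" "\<And>x. \<pi> $ \<sigma> x = \<pi> $ x"
  shows "(\<chi> x y. X $ \<sigma> x $ \<sigma> y) \<in> reversible_matrices \<pi>"
proof -
  have "bij \<sigma>"
    using \<sigma>(1) by (metis bijI')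
  then have "(\<Sum>y\<in>UNIV. X $ z $ \<sigma> y) = (\<Sum>y\<in>UNIV. X $ z $ y)" for z
    by (rule sum.reindex_bij_betw)
  moreover have "\<pi> $ x * X $ \<sigma> x $ \<sigma> y = \<pi> $ y * X $ \<sigma> y $ \<sigma> x" for x y
    using X \<sigma>(2) unfolding reversible_matrices_iff[OF \<pi>] by metis
  ultimately show ?thesis
    using X unfolding reversible_matrices_iff[OF \<pi>] by (simp add: transition_matrices_def)
qed

lemma reversible_average:
  assumes \<pi>: "full_support_pmf \<pi>"
    and "X \<in> reversible_matrices \<pi>" "Y \<in> reversible_matrices \<pi>"
  shows "(1/2) *\<^sub>R (X + Y) \<in> reversible_matrices \<pi>"
  using assms(2,3) unfolding reversible_matrices_iff[OF \<pi>]
  by (auto simp: transition_matrices_def sum.distrib algebra_simps simp flip: sum_divide_distrib)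

theorem theorem4p1:
  fixes \<pi> :: "real^'x" and P :: "real^'x^'x"
    and Q :: "nat \<Rightarrow> real^'x^'x" and m :: nat
  defines "R \<equiv> alternating_average \<pi> m Q P"
    and "E \<equiv> (\<Inter>k<m. Q_reversible_matrices \<pi> (Q k))"
  assumes "full_support_pmf \<pi>"
    and "1 \<le> m"
    and "P \<in> reversible_matrices \<pi>"
    and "\<And>k. k < m \<Longrightarrow> Q k \<in> isometric_involutions \<pi> \<inter> transition_matrices"
  shows "\<exists>Rinf :: real^'x^'x.
    (\<forall>x y. (\<lambda>n. R n $ x $ y) \<longlonglongrightarrow> Rinf $ x $ y) \<and>
    (\<lambda>n. TV_dist \<pi> (R n) Rinf) \<longlonglongrightarrow> 0 \<and>
    (\<forall>N. is_arg_min (KL_div \<pi> P) (\<lambda>N. N \<in> E) N \<longleftrightarrow> N = Rinf) \<and>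
    Rinf \<in> reversible_matrices \<pi> \<inter> E \<and>
    trace Rinf = trace P"
proof -

  \<comment> \<open>The iteration as averaging over conjugations\<close>
  note \<pi> = \<open>full_support_pmf \<pi>\<close>
  have pos: "0 < \<pi> $ x" for x
    using \<pi> by (auto simp: full_support_pmf_def)
  have "\<exists>\<sigma>. (\<forall>x. \<sigma> (\<sigma> x) = x) \<and> (\<forall>x. \<pi> $ \<sigma> x = \<pi> $ x) \<and>
    (\<forall>X x y. (Q k ** X ** Q k) $ x $ y = X $ \<sigma> x $ \<sigma> y)" if "k < m" for k
    using isometric_involution_permutation[OF \<pi> assms(6)[OF that]] by metis
  then obtain \<sigma> where inv: "\<And>k x. k < m \<Longrightarrow> \<sigma> k (\<sigma> k x) = x"
    and \<sigma>_\<pi>: "\<And>k x. k < m \<Longrightarrow> \<pi> $ \<sigma> k x = \<pi> $ x"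
    and conj: "\<And>k X x y. k < m \<Longrightarrow> (Q k ** X ** Q k) $ x $ y = X $ \<sigma> k x $ \<sigma> k y"
    by metis
  define S :: "nat \<Rightarrow> real^'x^'x \<Rightarrow> real^'x^'x" where "S k X = (\<chi> x y. X $ \<sigma> k x $ \<sigma> k y)" for k X
  have S: "Q k ** X ** Q k = S k X" if "k < m" for k X
    by (simp add: S_def vec_eq_iff conj that)
  have modm: "n mod m < m" for n
    using \<open>1 \<le> m\<close> by simp
  \<comment> \<open>Reversibility removes the adjoint from \<open>Q_average\<close>. The induction
    for \<open>R_rev\<close> uses this conditional form and then discharges its condition.\<close>
  have step': "R (Suc n) = (1/2) *\<^sub>R (R n + S (n mod m) (R n))" if "R n \<in> reversible_matrices \<pi>" for n
  proof -
    have "pi_adjoint \<pi> (R n) = R n"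
      using that by (simp add: reversible_matrices_def)
    then show ?thesis
      by (simp add: R_def Q_average_def S[OF modm])
  qed
  have R_rev: "R n \<in> reversible_matrices \<pi>" for n
  proof (induction n)
    case 0
    then show ?case
      by (simp add: R_def \<open>P \<in> reversible_matrices \<pi>\<close>)
  next
    case (Suc n)
    have "S (n mod m) (R n) \<in> reversible_matrices \<pi>"
      unfolding S_def using inv[OF modm] \<sigma>_\<pi>[OF modm] by (intro reversible_conjugate \<pi> Suc)
    then show ?case
      unfolding step'[OF Suc] by (intro reversible_average \<pi> Suc)
  qed
  note step = step'[OF R_rev]

  \<comment> \<open>The limit and its symmetries\<close>
  have "linear (S k)" for k
    by (rule linearI) (simp_all add: S_def vec_eq_iff)
  moreover have "norm (S k X) = norm X" if "k < m" for k X
    unfolding S_def by (rule norm_conjugate_permutation) (rule inv[OF that])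
  ultimately obtain L where lim: "R \<longlonglongrightarrow> L" and fix_L: "\<And>k. k < m \<Longrightarrow> S k L = L"
    using cyclic_averages_converge[of m R S] \<open>1 \<le> m\<close> step by metis
  have lim_entry: "(\<lambda>n. R n $ x $ y) \<longlonglongrightarrow> L $ x $ y" for x y
    by (intro tendsto_vec_nth lim)
  have L_rev: "L \<in> reversible_matrices \<pi>"
    using closed_sequentially[OF closed_reversible_matrices[OF \<pi>]] R_rev lim by blast
  have L_sym: "\<pi> $ x * L $ x $ y = \<pi> $ y * L $ y $ x" and L_nonneg: "0 \<le> L $ x $ y"
    and L_row: "(\<Sum>y\<in>UNIV. L $ x $ y) = 1" for x y
    using L_rev unfolding reversible_matrices_iff[OF \<pi>] by (auto simp: transition_matrices_def)
  have L_\<sigma>: "L $ \<sigma> k x $ \<sigma> k y = L $ x $ y" if "k < m" for k x y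
    using fix_L[OF that] by (metis S_def vec_lambda_beta)
  \<comment> \<open>As \<open>L\<close> is its own adjoint, \<open>S k L = L\<close> is the defining
    equation of \<open>Q_reversible_matrices \<pi> (Q k)\<close>.\<close>
  have L_E: "L \<in> E"
    using reversible_imp_stationary[OF \<pi> L_rev] L_rev
    by (simp add: E_def Q_reversible_matrices_def S fix_L reversible_matrices_def)

  \<comment> \<open>Conserved functionals and the trace\<close>
  have invariant: "(\<Sum>x\<in>UNIV. \<Sum>y\<in>UNIV. \<pi> $ x * L $ x $ y * g x y) =
      (\<Sum>x\<in>UNIV. \<Sum>y\<in>UNIV. \<pi> $ x * P $ x $ y * g x y)"
    if g: "\<And>k x y. k < m \<Longrightarrow> g (\<sigma> k x) (\<sigma> k y) = g y x" for g
  proof -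
    define F where "F X = (\<Sum>x\<in>UNIV. \<Sum>y\<in>UNIV. \<pi> $ x * X $ x $ y * g x y)" for X :: "real^'x^'x"
    \<comment> \<open>\<open>F\<close> is linear and takes equal values on \<open>R n\<close> and
      its conjugate, hence also on their midpoint.\<close>
    have "F (R n) = F P" for n
    proof (induction n)
      case (Suc n)
      have "F (S (n mod m) (R n)) = F (R n)"
        unfolding F_def S_def using inv[OF modm] \<sigma>_\<pi>[OF modm] g[OF modm]
        by (simp add: reversible_sum_conjugate[OF \<pi> R_rev])
      moreover have "F (R (Suc n)) = (F (R n) + F (S (n mod m) (R n))) / 2"
        unfolding step by (simp add: F_def sum.distrib algebra_simps add_divide_distrib sum_divide_distrib)
      ultimately show ?case
        using Suc by simp
    qed (simp add: R_def)
    moreover have "(\<lambda>n. F (R n)) \<longlonglongrightarrow> F L"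
      unfolding F_def by (intro tendsto_intros lim_entry)
    ultimately have "F L = F P"
      by (simp add: LIMSEQ_const_iff)
    then show ?thesis
      by (simp add: F_def)
  qed
  have tr: "trace L = trace P"
  proof -
    \<comment> \<open>The diagonal weight cancels the factor \<open>\<pi> $ x\<close>, so the
      conserved functional is the trace.\<close>
    define g where "g x y = (if x = y then 1 / \<pi> $ x else 0)" for x y
    have "g (\<sigma> k x) (\<sigma> k y) = g y x" if "k < m" for k x y
      using inv[OF that] \<sigma>_\<pi>[OF that] unfolding g_def by metis
    moreover have "(\<Sum>x\<in>UNIV. \<Sum>y\<in>UNIV. \<pi> $ x * X $ x $ y * g x y) = trace X" for X :: "real^'x^'x"
      using pos by (simp add: g_def trace_def if_distrib[of "\<lambda>t. _ * t"]
          less_imp_neq[THEN not_sym] cong: if_cong)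
    ultimately show ?thesis
      using invariant[of g] by simp
  qed

  \<comment> \<open>Absolute continuity and strict minimality\<close>
  have P_nonneg: "0 \<le> P $ x $ y" and P_row: "(\<Sum>y\<in>UNIV. P $ x $ y) = 1" for x y
    using \<open>P \<in> reversible_matrices \<pi>\<close> by (auto simp: reversible_matrices_def transition_matrices_def)
  have zero_iff: "(\<Sum>x\<in>UNIV. \<Sum>y\<in>UNIV. \<pi> $ x * X $ x $ y * of_bool (Z x y)) = 0 \<longleftrightarrow>
      (\<forall>x y. Z x y \<longrightarrow> X $ x $ y = 0)" if "\<And>x y. 0 \<le> X $ x $ y" for X :: "real^'x^'x" and Z
    using that pos
    by (simp add: sum_nonneg_eq_0_iff sum_nonneg less_imp_le less_imp_neq[THEN not_sym])
  \<comment> \<open>Conservation of mass on an invariant null set replaces a passage to the limit of supports.\<close>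
  have null: "(\<forall>x y. Z x y \<longrightarrow> L $ x $ y = 0) \<longleftrightarrow> (\<forall>x y. Z x y \<longrightarrow> P $ x $ y = 0)"
    if "\<And>k x y. k < m \<Longrightarrow> Z (\<sigma> k x) (\<sigma> k y) = Z y x" for Z
    using invariant[of "\<lambda>x y. of_bool (Z x y)"] zero_iff[of L Z] zero_iff[of P Z] that
      L_nonneg P_nonneg by simp
  have strict: "KL_div \<pi> P L < KL_div \<pi> P N" if N: "N \<in> E" "N \<noteq> L" for N
  proof -
    \<comment> \<open>By \<open>1 \<le> m\<close> the intersection \<open>E\<close> has a member
      with index 0, which makes \<open>N\<close> stochastic.\<close>
    have "N \<in> Q_reversible_matrices \<pi> (Q 0)"
      using N(1) \<open>1 \<le> m\<close> by (auto simp: E_def)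
    then have "N \<in> transition_matrices"
      by (simp add: Q_reversible_matrices_def stationary_matrices_def)
    then have N_nonneg: "0 \<le> N $ x $ y" and N_row: "(\<Sum>y\<in>UNIV. N $ x $ y) = 1" for x y
      by (auto simp: transition_matrices_def)
    \<comment> \<open>Membership in \<open>E\<close>, cleared of denominators, is the symmetry that
      \<open>invariant\<close> and \<open>null\<close> ask for.\<close>
    have N_\<sigma>: "\<pi> $ \<sigma> k x * N $ \<sigma> k x $ \<sigma> k y = \<pi> $ y * N $ y $ x" if "k < m" for k x y
    proof -
      have "pi_adjoint \<pi> N = S k N"
        using N(1) that by (auto simp: E_def Q_reversible_matrices_def S)
      then have "\<pi> $ y / \<pi> $ x * N $ y $ x = N $ \<sigma> k x $ \<sigma> k y"
        by (simp add: pi_adjoint_def S_def vec_eq_iff)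
      then show ?thesis
        using pos[of x] by (simp add: \<sigma>_\<pi>[OF that] field_simps)
    qed
    have L_\<sigma>': "\<pi> $ \<sigma> k x * L $ \<sigma> k x $ \<sigma> k y = \<pi> $ y * L $ y $ x" if "k < m" for k x y
      using L_\<sigma>[OF that] \<sigma>_\<pi>[OF that] L_sym by metis
    \<comment> \<open>The zero set of \<open>L\<close> is an invariant set on which \<open>L\<close>
      has no mass, so neither has \<open>P\<close>.\<close>
    have ac: "P $ x $ y = 0" if "L $ x $ y = 0" for x y
    proof -
      have "(\<pi> $ \<sigma> k x * L $ \<sigma> k x $ \<sigma> k y = 0) = (\<pi> $ y * L $ y $ x = 0)" if "k < m" for k x y
        using L_\<sigma>'[OF that] by simp
      from null[of "\<lambda>x y. \<pi> $ x * L $ x $ y = 0", OF this] show ?thesis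
        using that pos by (auto simp: less_imp_neq[THEN not_sym])
    qed
    define H where "H = (\<Sum>x\<in>UNIV. \<Sum>y\<in>UNIV. \<pi> $ x * P $ x $ y * ln (\<pi> $ x * P $ x $ y))"
    \<comment> \<open>The factor \<open>\<pi> x\<close> inside \<open>ln\<close> makes the symmetry of \<open>N\<close> an equality of arguments,
      so the junk value \<open>ln 0\<close> needs no case distinction.\<close>
    define K where "K M X = (\<Sum>x\<in>UNIV. \<Sum>y\<in>UNIV. \<pi> $ x * M $ x $ y * ln (\<pi> $ x * X $ x $ y))"
      for M X :: "real^'x^'x"
    \<comment> \<open>Conservation replaces the cross term \<open>K P L\<close> by
      \<open>K L L\<close>.\<close>
    have KL: "KL_div \<pi> P L = ereal (H - K L L)"
      using KL_div_finite[OF \<pi> P_nonneg L_nonneg ac]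
        invariant[of "\<lambda>x y. ln (\<pi> $ x * L $ x $ y)"] L_\<sigma>' by (simp add: H_def K_def)
    show ?thesis
    proof (cases "\<forall>x y. N $ x $ y = 0 \<longrightarrow> P $ x $ y = 0")
      case False
      then show ?thesis
        using KL_div_eq_infinity[OF \<pi>] KL by auto
    next
      case True
      then have "KL_div \<pi> P N = ereal (H - K P N)"
        unfolding H_def K_def using KL_div_finite[OF \<pi> P_nonneg N_nonneg] by blast
      also have "K P N = K L N"
        unfolding K_def by (rule invariant[symmetric]) (simp add: N_\<sigma>)
      finally have KN: "KL_div \<pi> P N = ereal (H - K L N)" .
      \<comment> \<open>In this case \<open>P\<close> vanishes on the zero set of \<open>N\<close>.
        That set is invariant, so \<open>L\<close> vanishes there too, as Gibbs' inequality
        requires.\<close>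
      have "(\<pi> $ \<sigma> k x * N $ \<sigma> k x $ \<sigma> k y = 0) = (\<pi> $ y * N $ y $ x = 0)" if "k < m" for k x y
        using N_\<sigma>[OF that] by simp
      from null[of "\<lambda>x y. \<pi> $ x * N $ x $ y = 0", OF this]
      have LN: "L $ x $ y = 0" if "N $ x $ y = 0" for x y
        using that True pos by (auto simp: less_imp_neq[THEN not_sym])
      obtain x y where xy: "L $ x $ y \<noteq> N $ x $ y"
        using N(2) by (metis vec_eq_iff)
      \<comment> \<open>Gibbs' inequality is applied to the joint weights on pairs; unit row sums
        give them equal totals.\<close>
      let ?a = "\<lambda>(x, y). \<pi> $ x * L $ x $ y" and ?b = "\<lambda>(x, y). \<pi> $ x * N $ x $ y"
      have pairs: "(\<Sum>x\<in>UNIV. \<Sum>y\<in>UNIV. f x y) = (\<Sum>(x, y)\<in>UNIV. f x y)" for f :: "'x \<Rightarrow> 'x \<Rightarrow> real"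
        by (simp add: sum.cartesian_product)
      have "sum ?a UNIV = sum ?b UNIV"
        unfolding pairs[symmetric] by (simp add: L_row N_row flip: sum_distrib_left)
      then have "(\<Sum>i\<in>UNIV. ?a i * ln (?b i)) < (\<Sum>i\<in>UNIV. ?a i * ln (?a i))"
        using xy pos LN L_nonneg N_nonneg
        by (intro gibbs_strict[where i = "(x, y)"]) (auto simp: less_imp_le less_imp_neq[THEN not_sym])
      \<comment> \<open>The difference is the divergence of \<open>L\<close> from \<open>N\<close>;
        the common term \<open>H\<close> cancels.\<close>
      then have "K L N < K L L"
        unfolding K_def pairs by (simp add: case_prod_unfold)
      then show ?thesis
        by (simp add: KL KN)
    qed
  qed
  \<comment> \<open>Strictness against every other member of \<open>E\<close> gives minimality of
    \<open>L\<close> and uniqueness at once.\<close>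
  have "is_arg_min (KL_div \<pi> P) (\<lambda>N. N \<in> E) N \<longleftrightarrow> N = L" for N
    using strict L_E unfolding is_arg_min_def by (metis order_less_asym order_less_irrefl)
  moreover have "(\<lambda>n. TV_dist \<pi> (R n) L) \<longlonglongrightarrow> 0"
  proof -
    have "(\<lambda>n. TV_dist \<pi> (R n) L) \<longlonglongrightarrow> TV_dist \<pi> L L"
      unfolding TV_dist_def by (intro tendsto_intros lim_entry)
    then show ?thesis
      by (simp add: TV_dist_def)
  qed
  ultimately show ?thesis
    using lim_entry L_rev L_E tr by blast
qed

end
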